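(* Let $X$ be a $W$-hyperbolic space, $C\subseteq X$ a convex subset, $T:C\to C$ a nonexpansive mapping with a fixed point $p$, $u,x_0,y_0\in C$, and $(\beta_n)_{n\in\mathbb N},(\lambda_n)_{n\in\mathbb N}$ sequences in $[0,1]$. Let $(x_n)$ be the Tikhonov-Mann iteration starting with $x_0$, $(u_n)$ its associated sequence $u_n=(1-\beta_n)u+\beta_nx_n$, and $(y_n)$ the modified Halpern iteration starting with $y_0$. Let $K\ge1$ be an integer with $K\ge\max\{d(x_0,p),d(u,p)\}$. Assume that $\lim_{n\to\infty}\beta_n=1$ with rate of convergence $\sigma_4:\mathbb N\to\mathbb N$, and put $\alpha(k)=\sigma_4(2K(k+1)-1)$. Let $\Omega:\mathbb N\times\mathbb N^{\mathbb N}\to\mathbb N$. Define $\Omega':\mathbb N\times\mathbb N^{\mathbb N}\to\mathbb N$ by $$\Omega'(k,g)=\widetilde\Omega(3k+2,g,\alpha(3k+2)),$$ where $\widetilde\Omega:\mathbb N\times\mathbb N^{\mathbb N}\times\mathbb N\to\mathbb N$ is given by $\widetilde\Omega(k,g,q)=\Omega(k,g_q)+q$, with $g_q:\mathbb N\to\mathbb N$, $g_q(n)=g(n+q)+q$. (i) If $\Omega$ is a rate of metastability of one of the sequences $(x_n)$, $(u_n)$, then $\Omega'$ is a rate of metastability of the other one. (ii) Suppose that $y_0=(1-\beta_0)u+\beta_0x_0$. If one of the sequences $(x_n)$, $(y_n)$ is Cauchy with rate of metastability $\Omega$, then the other one is Cauchy with rate of metastability $\Omega'$.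
   Context: A $W$-space is a metric space $(X,d)$ with a function $W:X\times X\times[0,1]\to X$; one writes $(1-\lambda)x+\lambda y$ for $W(x,y,\lambda)$. It is a $W$-hyperbolic space if for all $x,y,z,w\in X$ and $\lambda,\tilde\lambda\in[0,1]$: (W1) $d(z,(1-\lambda)x+\lambda y)\le(1-\lambda)d(z,x)+\lambda d(z,y)$; (W2) $d((1-\lambda)x+\lambda y,(1-\tilde\lambda)x+\tilde\lambda y)=|\lambda-\tilde\lambda|\,d(x,y)$; (W3) $(1-\lambda)x+\lambda y=\lambda y+(1-\lambda)x$, i.e. $W(x,y,\lambda)=W(y,x,1-\lambda)$; (W4) $d((1-\lambda)x+\lambda z,(1-\lambda)y+\lambda w)\le(1-\lambda)d(x,y)+\lambda d(z,w)$. A nonempty $C\subseteq X$ is convex if $(1-\lambda)x+\lambda y\in C$ for all $x,y\in C$, $\lambda\in[0,1]$. $T$ is nonexpansive if $d(Tx,Ty)\le d(x,y)$ for all $x,y\in C$. Tikhonov-Mann iteration: $x_{n+1}=(1-\lambda_n)u_n+\lambda_nTu_n$ with $u_n=(1-\beta_n)u+\beta_nx_n$. Modified Halpern iteration: $y_{n+1}=(1-\beta_{n+1})u+\beta_{n+1}v_n$ with $v_n=(1-\lambda_n)y_n+\lambda_nTy_n$. For a real sequence $a_n\to a$, a rate of convergence is $\varphi:\mathbb N\to\mathbb N$ with $|a_n-a|\le\frac1{k+1}$ for all $k\in\mathbb N$ and $n\ge\varphi(k)$. A function $\Omega:\mathbb N\times\mathbb N^{\mathbb N}\to\mathbb N$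 is a rate of metastability of a sequence $(a_n)$ in $X$ if for all $k\in\mathbb N$ and all $g:\mathbb N\to\mathbb N$ there exists $N\le\Omega(k,g)$ such that $d(a_i,a_j)\le\frac1{k+1}$ for all natural numbers $i,j\in[N,N+g(N)]$. (Existence of a rate of metastability is equivalent to $(a_n)$ being Cauchy.) *)

theory Defs
  imports "HOL-Analysis.Analysis"
begin

text \<open>
  \<^term>\<open>W x y t\<close> is the abstract convex combination $(1-t)x + ty$.  It is total in the real
  parameter \<^term>\<open>t\<close>, but only its values for \<^term>\<open>t\<close> in $[0,1]$ are constrained.
\<close>

locale W_hyperbolic_space =
  fixes W :: "'a::metric_space \<Rightarrow> 'a \<Rightarrow> real \<Rightarrow> 'a"
  assumes W1: "t \<in> {0..1} \<Longrightarrow> dist z (W x y t) \<le> (1 - t) * dist z x + t * dist z y"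
    and W2: "t \<in> {0..1} \<Longrightarrow> s \<in> {0..1} \<Longrightarrow> dist (W x y t) (W x y s) = \<bar>t - s\<bar> * dist x y"
    and W3: "t \<in> {0..1} \<Longrightarrow> W x y t = W y x (1 - t)"
    and W4: "t \<in> {0..1} \<Longrightarrow>
      dist (W x z t) (W y w t) \<le> (1 - t) * dist x y + t * dist z w"

definition W_convex :: "('a \<Rightarrow> 'a \<Rightarrow> real \<Rightarrow> 'a) \<Rightarrow> 'a set \<Rightarrow> bool" where
  "W_convex W C \<longleftrightarrow> C \<noteq> {} \<and> (\<forall>x\<in>C. \<forall>y\<in>C. \<forall>t\<in>{0..1}. W x y t \<in> C)"

definition nonexpansive_on :: "'a::metric_space set \<Rightarrow> ('a \<Rightarrow> 'a) \<Rightarrow> bool" where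
  "nonexpansive_on C T \<longleftrightarrow> (\<forall>x\<in>C. \<forall>y\<in>C. dist (T x) (T y) \<le> dist x y)"

definition anchored ::
  "('a \<Rightarrow> 'a \<Rightarrow> real \<Rightarrow> 'a) \<Rightarrow> 'a \<Rightarrow> (nat \<Rightarrow> real) \<Rightarrow> (nat \<Rightarrow> 'a) \<Rightarrow> nat \<Rightarrow> 'a" where
  "anchored W u \<beta> x n = W u (x n) (\<beta> n)"

primrec tikhonov_mann ::
  "('a \<Rightarrow> 'a \<Rightarrow> real \<Rightarrow> 'a) \<Rightarrow> ('a \<Rightarrow> 'a) \<Rightarrow> 'a \<Rightarrow> (nat \<Rightarrow> real) \<Rightarrow> (nat \<Rightarrow> real) \<Rightarrow> 'a \<Rightarrow> nat \<Rightarrow> 'a"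
where
  "tikhonov_mann W T u \<beta> lam x0 0 = x0"
| "tikhonov_mann W T u \<beta> lam x0 (Suc n) =
    (let u\<^sub>n = W u (tikhonov_mann W T u \<beta> lam x0 n) (\<beta> n) in W u\<^sub>n (T u\<^sub>n) (lam n))"

primrec modified_halpern ::
  "('a \<Rightarrow> 'a \<Rightarrow> real \<Rightarrow> 'a) \<Rightarrow> ('a \<Rightarrow> 'a) \<Rightarrow> 'a \<Rightarrow> (nat \<Rightarrow> real) \<Rightarrow> (nat \<Rightarrow> real) \<Rightarrow> 'a \<Rightarrow> nat \<Rightarrow> 'a"
where
  "modified_halpern W T u \<beta> lam y0 0 = y0"
| "modified_halpern W T u \<beta> lam y0 (Suc n) =
    (let y\<^sub>n = modified_halpern W T u \<beta> lam y0 n; v\<^sub>n = W y\<^sub>n (T y\<^sub>n) (lam n)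
     in W u v\<^sub>n (\<beta> (Suc n)))"

definition rate_of_convergence :: "(nat \<Rightarrow> nat) \<Rightarrow> (nat \<Rightarrow> real) \<Rightarrow> real \<Rightarrow> bool" where
  "rate_of_convergence \<phi> a l \<longleftrightarrow> (\<forall>k. \<forall>n\<ge>\<phi> k. \<bar>a n - l\<bar> \<le> 1 / (real k + 1))"

definition rate_of_metastability ::
  "(nat \<Rightarrow> (nat \<Rightarrow> nat) \<Rightarrow> nat) \<Rightarrow> (nat \<Rightarrow> 'a::metric_space) \<Rightarrow> bool" where
  "rate_of_metastability \<Omega> a \<longleftrightarrow>
    (\<forall>k g. \<exists>N\<le>\<Omega> k g. \<forall>i\<in>{N..N + g N}. \<forall>j\<in>{N..N + g N}. dist (a i) (a j) \<le> 1 / (real k + 1))"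

definition shift_fun :: "(nat \<Rightarrow> nat) \<Rightarrow> nat \<Rightarrow> nat \<Rightarrow> nat" where
  "shift_fun g q n = g (n + q) + q"

definition Omega_tilde ::
  "(nat \<Rightarrow> (nat \<Rightarrow> nat) \<Rightarrow> nat) \<Rightarrow> nat \<Rightarrow> (nat \<Rightarrow> nat) \<Rightarrow> nat \<Rightarrow> nat" where
  "Omega_tilde \<Omega> k g q = \<Omega> k (shift_fun g q) + q"

definition Omega_prime ::
  "(nat \<Rightarrow> nat) \<Rightarrow> (nat \<Rightarrow> (nat \<Rightarrow> nat) \<Rightarrow> nat) \<Rightarrow> nat \<Rightarrow> (nat \<Rightarrow> nat) \<Rightarrow> nat" where
  "Omega_prime \<alpha> \<Omega> k g = Omega_tilde \<Omega> (3 * k + 2) g (\<alpha> (3 * k + 2))"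

text \<open>The subtraction is on \<^typ>\<open>nat\<close>; it does not truncate when \<^term>\<open>K \<ge> (1::nat)\<close>.\<close>

definition alpha_rate :: "nat \<Rightarrow> (nat \<Rightarrow> nat) \<Rightarrow> nat \<Rightarrow> nat" where
  "alpha_rate K \<sigma> k = \<sigma> (2 * K * (k + 1) - 1)"

end

theory Submission
  imports Defs
begin

text \<open>
  The sequences $(x_n)$ and $(u_n)$ are asymptotically equal: both stay in the ball of radius $K$
  around the fixed point, so $d(x_n,u_n) \le (1-\beta_n)\,d(x_n,u) \le 2K(1-\beta_n)$, which is at most
  $1/(k+1)$ for $n \ge \alpha(k)$. Hence metastability passes from one to the other with three
  errors of size $1/(3k+3)$, once the interval is pushed beyond $q = \alpha(3k+2)$; the shifted
  counterfunction $g_q$ pays for that. For (ii), matching initial values give $y_n = u_n$ for all $n$.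
\<close>

text \<open>If \<open>a\<close> is not Cauchy, choose for each \<open>N\<close> a pair of indices
  \<open>m N\<close>, \<open>n N\<close> beyond \<open>N\<close> whose terms stay \<open>e\<close>
  apart. The counterfunction \<open>m N + n N\<close> makes the interval starting at
  \<open>N\<close> long enough to contain that pair, contradicting metastability at a
  \<open>k\<close> with \<open>1 / (k + 1) < e\<close>.\<close>

lemma rate_of_metastability_imp_Cauchy:
  assumes "rate_of_metastability \<Omega> a"
  shows "Cauchy a"
proof (rule ccontr)
  assume "\<not> Cauchy a"
  then obtain e where "e > 0" and far: "\<forall>N. \<exists>m\<ge>N. \<exists>n\<ge>N. \<not> dist (a m) (a n) < e"
    unfolding Cauchy_def by blast
  then obtain m n where mn: "\<And>N. m N \<ge> N" "\<And>N. n N \<ge> N" "\<And>N. \<not> dist (a (m N)) (a (n N)) < e"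
    by metis
  obtain k :: nat where k: "1 / (real k + 1) < e"
    using reals_Archimedean[OF \<open>e > 0\<close>] by (auto simp: inverse_eq_divide add.commute)
  obtain N where N: "\<And>i j. i \<in> {N..N + (m N + n N)} \<Longrightarrow> j \<in> {N..N + (m N + n N)} \<Longrightarrow>
      dist (a i) (a j) \<le> 1 / (real k + 1)"
    using assms[unfolded rate_of_metastability_def, rule_format, of k "\<lambda>N. m N + n N"] by blast
  have "dist (a (m N)) (a (n N)) \<le> 1 / (real k + 1)"
    using mn(1,2)[of N] by (intro N) auto
  with k mn(3)[of N] show False
    by linarith
qed

text \<open>Kept free of the iterations, so that it serves both directions with the roles of
  \<open>a\<close> and \<open>b\<close> exchanged.\<close>

lemma rate_of_metastability_transfer:
  assumes close: "\<And>k n. n \<ge> \<alpha> k \<Longrightarrow> dist (a n) (b n) \<le> 1 / (real k + 1)"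
    and "rate_of_metastability \<Omega> a"
  shows "rate_of_metastability (Omega_prime \<alpha> \<Omega>) b"
  unfolding rate_of_metastability_def
proof (intro allI)
  fix k g
  define q where "q = \<alpha> (3 * k + 2)"
  obtain N where "N \<le> \<Omega> (3 * k + 2) (shift_fun g q)"
    and N: "\<forall>i\<in>{N..N + shift_fun g q N}. \<forall>j\<in>{N..N + shift_fun g q N}.
      dist (a i) (a j) \<le> 1 / (real (3 * k + 2) + 1)"
    using assms(2) unfolding rate_of_metastability_def by blast
  define e where "e = 1 / (real k + 1)"
  have third: "1 / (real (3 * k + 2) + 1) = e / 3"
    by (simp add: e_def field_simps)
  \<comment> \<open>The witness for \<open>b\<close> is \<open>N + q\<close>. Its interval ends
    exactly where \<open>{N..N + shift_fun g q N}\<close> does, so the bound for \<open>a\<close>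
    applies, and all its indices are at least \<open>q\<close>, so \<open>close\<close>
    applies.\<close>
  have "dist (b i) (b j) \<le> e"
    if "i \<in> {N + q..N + q + g (N + q)}" "j \<in> {N + q..N + q + g (N + q)}" for i j
  proof -
    have "dist (a i) (a j) \<le> e / 3"
      using N that unfolding third by (auto simp: shift_fun_def)
    moreover have "dist (a i) (b i) \<le> e / 3" "dist (a j) (b j) \<le> e / 3"
      using close[of "3 * k + 2" i] close[of "3 * k + 2" j] that unfolding third q_def by auto
    moreover have "dist (b i) (b j) \<le> dist (a i) (b i) + dist (a i) (a j) + dist (a j) (b j)"
      using dist_triangle[of "b i" "b j" "a i"] dist_triangle[of "a i" "b j" "a j"]
      by (simp add: dist_commute)
    ultimately show ?thesis
      by linarith
  qed
  moreover have "N + q \<le> Omega_prime \<alpha> \<Omega> k g"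
    using \<open>N \<le> _\<close> by (simp add: Omega_prime_def Omega_tilde_def q_def)
  ultimately show "\<exists>N\<le>Omega_prime \<alpha> \<Omega> k g. \<forall>i\<in>{N..N + g N}. \<forall>j\<in>{N..N + g N}.
      dist (b i) (b j) \<le> 1 / (real k + 1)"
    unfolding e_def by blast
qed

context W_hyperbolic_space
begin

lemma dist_W_le:
  assumes "t \<in> {0..1}" "dist z x \<le> r" "dist z y \<le> r"
  shows "dist z (W x y t) \<le> r"
proof -
  have "dist z (W x y t) \<le> (1 - t) * dist z x + t * dist z y"
    using assms(1) by (rule W1)
  also have "\<dots> \<le> (1 - t) * r + t * r"
    using assms by (intro add_mono mult_left_mono) auto
  also have "\<dots> = r"
    by (simp add: algebra_simps)
  finally show ?thesis .
qed

text \<open>Closed balls around \<open>p\<close> are stable under convex combinations by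
  \<open>dist_W_le\<close>, and \<open>T\<close> maps their points in \<open>C\<close> back into
  them because \<open>p\<close> is fixed. Membership in \<open>C\<close> is part of the induction
  since nonexpansiveness is available only there.\<close>

lemma tikhonov_mann_bounded:
  assumes C: "W_convex W C" "T \<in> C \<rightarrow> C" "nonexpansive_on C T" "p \<in> C" "T p = p"
    and "u \<in> C" "x0 \<in> C" and coeff: "\<forall>n. \<beta> n \<in> {0..1}" "\<forall>n. lam n \<in> {0..1}"
    and r: "dist p x0 \<le> r" "dist p u \<le> r"
  shows "tikhonov_mann W T u \<beta> lam x0 n \<in> C \<and> dist p (tikhonov_mann W T u \<beta> lam x0 n) \<le> r"
proof (induction n)
  case 0
  then show ?case
    using assms by simp
next
  case (Suc n)
  define v where "v = W u (tikhonov_mann W T u \<beta> lam x0 n) (\<beta> n)"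
  have "v \<in> C" "dist p v \<le> r"
    using Suc C(1) \<open>u \<in> C\<close> coeff(1) r(2) unfolding v_def
    by (auto simp: W_convex_def intro!: dist_W_le)
  moreover from this have "T v \<in> C"
    using C(2) by blast
  moreover have "dist p (T v) \<le> dist p v"
    using C(3-5) \<open>v \<in> C\<close> unfolding nonexpansive_on_def by metis
  ultimately have "W v (T v) (lam n) \<in> C" "dist p (W v (T v) (lam n)) \<le> r"
    using C(1) coeff(2) by (auto simp: W_convex_def intro!: dist_W_le)
  then show ?case
    by (simp add: v_def Let_def)
qed

text \<open>Take \<open>z = x n\<close> in \<open>W1\<close>: the term weighted by
  \<open>\<beta> n\<close> is the distance of \<open>x n\<close> to itself and vanishes.\<close>

lemma dist_anchored_le:
  assumes "\<beta> n \<in> {0..1}"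
  shows "dist (x n) (anchored W u \<beta> x n) \<le> (1 - \<beta> n) * dist (x n) u"
  using W1[OF assms, of "x n" u "x n"] by (simp add: anchored_def)

end

text \<open>The two schemes alternate the same two operations. If \<open>y\<close> agrees with the
  anchored sequence at \<open>n\<close>, the inner Halpern point \<open>v\<close> is the next
  Tikhonov-Mann iterate, and anchoring it gives the next Halpern iterate.\<close>

lemma modified_halpern_eq_anchored:
  assumes "y0 = W u x0 (\<beta> 0)"
  shows "modified_halpern W T u \<beta> lam y0 = anchored W u \<beta> (tikhonov_mann W T u \<beta> lam x0)"
proof
  show "modified_halpern W T u \<beta> lam y0 n = anchored W u \<beta> (tikhonov_mann W T u \<beta> lam x0) n" for n
    using assms by (induction n) (simp_all add: anchored_def Let_def)
qed

lemma alpha_rate: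
  assumes "rate_of_convergence \<sigma> \<beta> 1" "K \<ge> 1" "n \<ge> alpha_rate K \<sigma> k"
  shows "2 * real K * \<bar>\<beta> n - 1\<bar> \<le> 1 / (real k + 1)"
proof -
  \<comment> \<open>Rules out truncation, so the \<open>- 1\<close> in \<open>alpha_rate\<close>
    cancels the \<open>+ 1\<close> in the denominator of the rate of convergence.\<close>
  have "2 * K * (k + 1) \<ge> 1"
    using assms(2) by simp
  then have "real (2 * K * (k + 1) - 1) + 1 = 2 * real K * (real k + 1)"
    by (subst of_nat_diff) (simp_all add: algebra_simps)
  moreover have "\<bar>\<beta> n - 1\<bar> \<le> 1 / (real (2 * K * (k + 1) - 1) + 1)"
    using assms(1,3) unfolding rate_of_convergence_def alpha_rate_def by blast
  ultimately have "2 * real K * \<bar>\<beta> n - 1\<bar> \<le> 2 * real K * (1 / (2 * real K * (real k + 1)))"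
    by (intro mult_left_mono) simp_all
  also have "\<dots> = 1 / (real k + 1)"
    using assms(2) by simp
  finally show ?thesis .
qed

theorem proposition5p1:
  fixes W :: "'a::metric_space \<Rightarrow> 'a \<Rightarrow> real \<Rightarrow> 'a"
    and C :: "'a set" and T :: "'a \<Rightarrow> 'a" and p u x0 y0 :: 'a
    and \<beta> lam :: "nat \<Rightarrow> real"
    and x us y :: "nat \<Rightarrow> 'a"
    and K :: nat and \<sigma>\<^sub>4 :: "nat \<Rightarrow> nat"
    and \<Omega> \<Omega>' :: "nat \<Rightarrow> (nat \<Rightarrow> nat) \<Rightarrow> nat"
  assumes "W_hyperbolic_space W"
    and "W_convex W C"
    and "T \<in> C \<rightarrow> C" and "nonexpansive_on C T"
    and "p \<in> C" and "T p = p"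
    and "u \<in> C" and "x0 \<in> C" and "y0 \<in> C"
    and "\<forall>n. \<beta> n \<in> {0..1}" and "\<forall>n. lam n \<in> {0..1}"
    and "x = tikhonov_mann W T u \<beta> lam x0"
    and "us = anchored W u \<beta> x"
    and "y = modified_halpern W T u \<beta> lam y0"
    and "K \<ge> 1" and "real K \<ge> max (dist x0 p) (dist u p)"
    and "\<beta> \<longlonglongrightarrow> 1" and "rate_of_convergence \<sigma>\<^sub>4 \<beta> 1"
    and "\<Omega>' = Omega_prime (alpha_rate K \<sigma>\<^sub>4) \<Omega>"
  shows "((rate_of_metastability \<Omega> x \<longrightarrow> rate_of_metastability \<Omega>' us) \<and>
          (rate_of_metastability \<Omega> us \<longrightarrow> rate_of_metastability \<Omega>' x)) \<and>
         (y0 = W u x0 (\<beta> 0) \<longrightarrow>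
          (Cauchy x \<and> rate_of_metastability \<Omega> x \<longrightarrow> Cauchy y \<and> rate_of_metastability \<Omega>' y) \<and>
          (Cauchy y \<and> rate_of_metastability \<Omega> y \<longrightarrow> Cauchy x \<and> rate_of_metastability \<Omega>' x))"
proof -
  interpret W_hyperbolic_space W by fact
  have close: "dist (x n) (us n) \<le> 1 / (real k + 1)" if "n \<ge> alpha_rate K \<sigma>\<^sub>4 k" for k n
  proof -
    have "dist p u \<le> K" "dist p x0 \<le> K"
      using assms(16) by (simp_all add: dist_commute)
    \<comment> \<open>Triangle inequality through \<open>p\<close>; this is the source of the factor
      \<open>2 * K\<close> in \<open>alpha_rate\<close>.\<close>
    then have "dist (x n) u \<le> 2 * real K"
      using tikhonov_mann_bounded[OF assms(2-8,10,11), of K n] dist_triangle2[of "x n" u p] assms(12)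
      by (simp add: dist_commute)
    then have "(1 - \<beta> n) * dist (x n) u \<le> (1 - \<beta> n) * (2 * real K)"
      using assms(10) by (intro mult_left_mono) auto
    moreover have "dist (x n) (us n) \<le> (1 - \<beta> n) * dist (x n) u"
      using dist_anchored_le assms(10,13) by blast
    moreover have "\<bar>\<beta> n - 1\<bar> = 1 - \<beta> n"
      using assms(10) by (simp add: abs_minus_commute)
    ultimately show ?thesis
      using alpha_rate[OF assms(18,15) that] by (simp add: mult.commute)
  qed
  then have close': "dist (us n) (x n) \<le> 1 / (real k + 1)" if "n \<ge> alpha_rate K \<sigma>\<^sub>4 k" for k n
    using that by (simp add: dist_commute)
  have x_us: "rate_of_metastability \<Omega>' us" if "rate_of_metastability \<Omega> x"
    unfolding assms(19) using close that by (rule rate_of_metastability_transfer)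
  have us_x: "rate_of_metastability \<Omega>' x" if "rate_of_metastability \<Omega> us"
    unfolding assms(19) using close' that by (rule rate_of_metastability_transfer)
  have "y = us" if "y0 = W u x0 (\<beta> 0)"
    unfolding assms(12-14) using that by (rule modified_halpern_eq_anchored)
  \<comment> \<open>Identifying \<open>y\<close> with \<open>us\<close> reduces (ii) to (i); the
    Cauchy claims follow from the transferred rates.\<close>
  with x_us us_x show ?thesis
    using rate_of_metastability_imp_Cauchy by blast
qed

end
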